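(* Let $f$ be a transcendental entire function with $F(f)\neq\emptyset$ and $f\in\Delta$. If $0<\rho(f)\le\lambda(f)<\infty$, then $F(f)$ is uniformly bounded, i.e. $B_2(f)<\infty$.
   Context: For a transcendental entire function $f$, the Fatou set $F(f)$ is the set of $z\in\mathbb C$ such that the sequence of iterates $\{f^n\}_{n\ge1}$ is normal (in the sense of Montel, with the constant limit $\infty$ allowed) in some neighborhood of $z$. Write $M(r,f)=\max\{|f(z)|:|z|=r\}$ and $m(r,f)=\min\{|f(z)|:|z|=r\}$. The order and lower order of $f$ are $$\lambda(f)=\limsup_{r\to\infty}\frac{\log\log M(r,f)}{\log r},\qquad \rho(f)=\liminf_{r\to\infty}\frac{\log\log M(r,f)}{\log r}.$$ For $E\subset[1,\infty)$ the upper logarithmic density is $\overline{\log\mathrm{dens}}\,E=\limsup_{R\to\infty}\frac{1}{\log R}\int_{E\cap(1,R)}\frac{dt}{t}$. A transcendental entire function $f$ belongs to the class $\Delta$ if there exist constants $\varepsilon_1,\varepsilon_2$ with $0<\varepsilon_1,\varepsilon_2<1$ such that $\overline{\log\mathrm{dens}}\,E(f)\le\varepsilon_1$, where $E(f)=\{r>1:\log m(r,f)\le\varepsilon_2\log M(r,f)\}$ (with $\log 0=-\infty$). Define $$B_2(f)=\sup_U\frac{\sup_{z\in U}\log\log(|z|+30)}{\inf_{w\in U}\log(|w|+3)},$$ where $\sup_U$ is over all connected components $U$ of $F(f)$ (a term is $+\infty$ if $U$ is unbounded). $F(f)$ is called uniformly bounded if $B_2(f)<\infty$. *)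

theory Defs
  imports "HOL-Complex_Analysis.Complex_Analysis"
begin

definition transcendental_entire :: "(complex \<Rightarrow> complex) \<Rightarrow> bool" where
  "transcendental_entire f \<longleftrightarrow>
     f holomorphic_on UNIV \<and> \<not> (\<exists>p. \<forall>z. f z = poly p z)"

text \<open>
  Normality in the sense of Montel, with the constant limit infinity allowed. On a connected
  open set the two alternatives below are exactly the locally uniform limits with respect
  to the spherical metric, so the notion is only used for such sets.
\<close>
definition normal_family_on :: "(complex \<Rightarrow> complex) set \<Rightarrow> complex set \<Rightarrow> bool" where
  "normal_family_on \<F> U \<longleftrightarrow>
     (\<forall>g :: nat \<Rightarrow> complex \<Rightarrow> complex. range g \<subseteq> \<F> \<longrightarrow>
        (\<exists>r :: nat \<Rightarrow> nat. strict_mono r \<and>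
           ((\<exists>h. h holomorphic_on U \<and>
               (\<forall>K. compact K \<and> K \<subseteq> U \<longrightarrow> uniform_limit K (\<lambda>k. g (r k)) h sequentially))
            \<or> (\<forall>K. compact K \<and> K \<subseteq> U \<longrightarrow>
                 (\<forall>B :: real. \<forall>\<^sub>F k in sequentially. \<forall>z\<in>K. B < norm (g (r k) z))))))"

definition Fatou_set :: "(complex \<Rightarrow> complex) \<Rightarrow> complex set" where
  "Fatou_set f =
     {z. \<exists>U. open U \<and> connected U \<and> z \<in> U \<and> normal_family_on {f ^^ n | n. 1 \<le> n} U}"

text \<open>For continuous functions and nonnegative radii the supremum and infimum are attained.\<close>
definition max_modulus :: "real \<Rightarrow> (complex \<Rightarrow> complex) \<Rightarrow> real" where
  "max_modulus r f = (SUP z\<in>sphere 0 r. norm (f z))"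

definition min_modulus :: "real \<Rightarrow> (complex \<Rightarrow> complex) \<Rightarrow> real" where
  "min_modulus r f = (INF z\<in>sphere 0 r. norm (f z))"

definition growth_order :: "(complex \<Rightarrow> complex) \<Rightarrow> ereal" where
  "growth_order f = Limsup at_top (\<lambda>r. ereal (ln (ln (max_modulus r f)) / ln r))"

definition lower_growth_order :: "(complex \<Rightarrow> complex) \<Rightarrow> ereal" where
  "lower_growth_order f = Liminf at_top (\<lambda>r. ereal (ln (ln (max_modulus r f)) / ln r))"

definition upper_log_density :: "real set \<Rightarrow> ereal" where
  "upper_log_density E =
     Limsup at_top (\<lambda>R. ereal (1 / ln R * (LINT t:E \<inter> {1<..<R}|lebesgue. 1 / t)))"

text \<open>The real logarithm of the library has the value 0 at 0, so the convention that
  the logarithm of 0 is minus infinity needs an extended version.\<close>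
definition log_ext :: "real \<Rightarrow> ereal" where
  "log_ext x = (if x \<le> 0 then -\<infinity> else ereal (ln x))"

definition small_min_modulus_set :: "real \<Rightarrow> (complex \<Rightarrow> complex) \<Rightarrow> real set" where
  "small_min_modulus_set \<epsilon> f =
     {r. 1 < r \<and> log_ext (min_modulus r f) \<le> ereal \<epsilon> * log_ext (max_modulus r f)}"

definition class_Delta :: "(complex \<Rightarrow> complex) set" where
  "class_Delta =
     {f. transcendental_entire f \<and>
         (\<exists>\<epsilon>\<^sub>1 \<epsilon>\<^sub>2 :: real. 0 < \<epsilon>\<^sub>1 \<and> \<epsilon>\<^sub>1 < 1 \<and> 0 < \<epsilon>\<^sub>2 \<and> \<epsilon>\<^sub>2 < 1 \<and>
            upper_log_density (small_min_modulus_set \<epsilon>\<^sub>2 f) \<le> ereal \<epsilon>\<^sub>1)}"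

text \<open>For an unbounded component the numerator is infinite, while the denominator is
  finite and at least the logarithm of 3; hence the quotient is infinite.\<close>
definition B2 :: "(complex \<Rightarrow> complex) \<Rightarrow> ereal" where
  "B2 f = (SUP U\<in>components (Fatou_set f).
     (SUP z\<in>U. ereal (ln (ln (norm z + 30)))) / (INF w\<in>U. ereal (ln (norm w + 3))))"

definition Fatou_uniformly_bounded :: "(complex \<Rightarrow> complex) \<Rightarrow> bool" where
  "Fatou_uniformly_bounded f \<longleftrightarrow> B2 f < \<infinity>"

end

theory Submission
  imports Defs
begin

text \<open>
  Suppose a continuum \<open>\<gamma>\<close> in a Fatou component joins the point \<open>w\<close>, \<open>|w| \<le> R\<close>, to modulus at least
  \<open>exp (R powr (L + 1))\<close>, where \<open>L\<close> exceeds the order and \<open>R\<close> is large. The density condition yields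
  a circle of radius only a power smaller than this that meets \<open>\<gamma>\<close> and on which \<open>|f|\<close> is at least a
  power of the maximum modulus. As the lower order is positive, \<open>f ` \<gamma>\<close> then joins
  \<open>f w\<close>, of modulus at most \<open>R' = exp (R powr L)\<close>, to modulus at least \<open>exp (R' powr (L + 1))\<close>, and the
  argument iterates. On the other hand, normality and Harnack's inequality bound the ratio of the
  logarithmic sizes of the iterates over \<open>\<gamma>\<close> uniformly in the number of iterations, which is
  incompatible with this growth. Hence a component meeting the disc of radius \<open>R\<close> lies in the
  disc of radius \<open>exp (R powr (L + 1))\<close>.
\<close>

subsection \<open>Maximum and minimum modulus\<close>

text \<open>Scaling the unit circle by r parametrises all spheres by one fixed set. Uniform
  continuity of g on a slightly larger ball then makes g at the points s u and r u close, uniformly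
  in the unit vector u, and suprema inherit this closeness.\<close>

lemma continuous_on_SUP_sphere:
  fixes g :: "complex \<Rightarrow> real"
  assumes "continuous_on UNIV g"
  shows "continuous_on {0..} (\<lambda>r. SUP z\<in>sphere 0 r. g z)"
proof -
  have sph: "sphere (0::complex) r = (\<lambda>u. of_real r * u) ` sphere 0 1" if "r \<ge> 0" for r :: real
  proof (cases "r = 0")
    case True
    then show ?thesis using exI[of "\<lambda>x::complex. norm x = 1" 1] by (auto simp: image_iff)
  next
    case False
    show ?thesis
    proof (intro equalityI subsetI)
      fix z :: complex assume "z \<in> sphere 0 r"
      with False that show "z \<in> (\<lambda>u. of_real r * u) ` sphere 0 1"
        by (intro image_eqI[of _ _ "z / of_real r"]) (auto simp: norm_divide)
    qed (use that in \<open>auto simp: norm_mult\<close>)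
  qed
  have le: "(SUP z\<in>sphere 0 s. g z) \<le> (SUP z\<in>sphere 0 r. g z) + e"
    if "0 \<le> r" and s0: "0 \<le> s" and gle: "\<And>u. norm u = 1 \<Longrightarrow> g (of_real s * u) \<le> g (of_real r * u) + e" for r s e
  proof (rule cSUP_least)
    show "sphere (0::complex) s \<noteq> {}" using that by simp
    fix z :: complex assume "z \<in> sphere 0 s"
    then obtain u where u: "norm u = 1" "z = of_real s * u"
      unfolding sph[OF s0] by auto
    have "bdd_above (g ` sphere 0 r)"
      by (intro bounded_imp_bdd_above compact_imp_bounded compact_continuous_image
          continuous_on_subset[OF assms]) auto
    then have "g (of_real r * u) \<le> (SUP z\<in>sphere 0 r. g z)"
      by (rule cSUP_upper[rotated]) (use u that in \<open>auto simp: norm_mult\<close>)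
    with gle[OF u(1)] u show "g z \<le> (SUP z\<in>sphere 0 r. g z) + e" by auto
  qed
  show ?thesis
    unfolding continuous_on_iff
  proof (intro ballI allI impI)
    fix r e :: real assume r: "r \<in> {0..}" and "0 < e"
    have "uniformly_continuous_on (cball 0 (r + 1)) g"
      by (rule compact_uniformly_continuous[OF continuous_on_subset[OF assms]]) auto
    then obtain d where "d > 0" and d: "\<And>x y. \<lbrakk>x \<in> cball 0 (r+1); y \<in> cball 0 (r+1); dist y x < d\<rbrakk>
        \<Longrightarrow> dist (g y) (g x) < e / 2"
      unfolding uniformly_continuous_on_def using \<open>0 < e\<close> half_gt_zero by metis
    show "\<exists>d>0. \<forall>s\<in>{0..}. dist s r < d \<longrightarrow>
        dist (SUP z\<in>sphere 0 s. g z) (SUP z\<in>sphere 0 r. g z) < e"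
    proof (intro exI[of _ "min d 1"] conjI ballI impI)
      fix s :: real assume s: "s \<in> {0..}" "dist s r < min d 1"
      have near: "dist (g (of_real s * u)) (g (of_real r * u)) < e / 2" if "norm u = 1" for u
      proof (rule d)
        have "dist (of_real s * u) (of_real r * u) = norm (of_real (s - r) * u)"
          by (simp add: dist_norm algebra_simps)
        also have "\<dots> = \<bar>s - r\<bar>" using that by (simp only: norm_mult norm_of_real mult_1_right)
        finally show "dist (of_real s * u) (of_real r * u) < d" using s by (simp add: dist_norm)
      qed (use that s r in \<open>auto simp: norm_mult dist_norm\<close>)
      have near2: "g (of_real s * u) \<le> g (of_real r * u) + e / 2"
          "g (of_real r * u) \<le> g (of_real s * u) + e / 2" if "norm u = 1" for u
        using near[OF that] unfolding dist_real_def by linarith+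
      have "(SUP z\<in>sphere 0 s. g z) \<le> (SUP z\<in>sphere 0 r. g z) + e / 2"
        using s r near2 by (intro le) auto
      moreover have "(SUP z\<in>sphere 0 r. g z) \<le> (SUP z\<in>sphere 0 s. g z) + e / 2"
        using s r near2 by (intro le) auto
      ultimately show "dist (SUP z\<in>sphere 0 s. g z) (SUP z\<in>sphere 0 r. g z) < e"
        using \<open>0 < e\<close> by (simp add: dist_real_def abs_less_iff)
    qed (use \<open>d > 0\<close> in auto)
  qed
qed

lemma continuous_on_max_modulus:
  assumes "continuous_on UNIV f"
  shows "continuous_on {0..} (\<lambda>r. max_modulus r f)"
  unfolding max_modulus_def
  by (intro continuous_on_SUP_sphere continuous_intros assms)

text \<open>A real infimum is minus the supremum of the negated values, so the result on suprema
  applies to -|f|.\<close>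

lemma continuous_on_min_modulus:
  assumes "continuous_on UNIV f"
  shows "continuous_on {0..} (\<lambda>r. min_modulus r f)"
  unfolding min_modulus_def Inf_real_def image_image
  by (intro continuous_on_minus continuous_on_SUP_sphere continuous_intros assms)

text \<open>Measurability makes 1/t integrable over the bounded pieces of the exceptional set, so
  that integrals over it can be compared with integrals over intervals.\<close>

lemma sets_small_min_modulus_set:
  assumes "continuous_on UNIV f"
  shows "small_min_modulus_set \<epsilon> f \<in> sets borel"
proof -
  \<comment> \<open>Continuity of the moduli is available only for nonnegative radii. Composing with
    \<open>max r 0\<close> extends it to the whole line and changes nothing for r > 1.\<close>
  have comp: "(\<lambda>r. F (max r 0)) \<in> borel_measurable borel"
    if "continuous_on {0..} F" for F :: "real \<Rightarrow> real"
    by (intro borel_measurable_continuous_onI continuous_on_compose2[OF that] continuous_intros) auto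
  have [measurable]: "(\<lambda>r. max_modulus (max r 0) f) \<in> borel_measurable borel"
      "(\<lambda>r. min_modulus (max r 0) f) \<in> borel_measurable borel"
    using comp continuous_on_max_modulus[OF assms] continuous_on_min_modulus[OF assms] by auto
  have [measurable]: "log_ext \<in> borel_measurable borel"
    unfolding log_ext_def by measurable
  have "{r \<in> space borel. 1 < r \<and> log_ext (min_modulus (max r 0) f) \<le> ereal \<epsilon> * log_ext (max_modulus (max r 0) f)}
      \<in> sets borel"
    by measurable
  also have "{r \<in> space borel. 1 < r \<and> log_ext (min_modulus (max r 0) f) \<le> ereal \<epsilon> * log_ext (max_modulus (max r 0) f)}
      = small_min_modulus_set \<epsilon> f"
    by (auto simp: small_min_modulus_set_def max_def)
  finally show ?thesis .
qed

lemma norm_le_max_modulus: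
  assumes "f holomorphic_on UNIV" "norm z \<le> r"
  shows "norm (f z) \<le> max_modulus r f"
proof (rule maximum_modulus_frontier[where f = f and S = "cball 0 r"])
  fix z :: complex assume z: "z \<in> frontier (cball 0 r)"
  have "bdd_above ((\<lambda>z. norm (f z)) ` sphere 0 r)"
    by (intro bounded_imp_bdd_above compact_imp_bounded compact_continuous_image continuous_intros
        holomorphic_on_imp_continuous_on holomorphic_on_subset[OF assms(1)]) auto
  then show "norm (f z) \<le> max_modulus r f"
    unfolding max_modulus_def using z by (intro cSUP_upper) auto
qed (use assms in \<open>auto intro!: holomorphic_on_imp_continuous_on intro: holomorphic_on_subset\<close>)

lemma min_modulus_le: "min_modulus (norm z) f \<le> norm (f z)"
  unfolding min_modulus_def by (rule cINF_lower) (auto intro!: bdd_belowI2[of _ 0])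

section \<open>Growth of the maximum modulus and circles with large minimum modulus\<close>

text \<open>By Liouville's theorem a bounded entire function is a constant polynomial. Having M(r) >
  1 keeps ln M(r) positive, so the iterated logarithm can be inverted.\<close>

lemma eventually_max_modulus_gt_1:
  assumes "transcendental_entire f"
  shows "eventually (\<lambda>r. 1 < max_modulus r f) at_top"
proof -
  have hol: "f holomorphic_on UNIV" using assms by (simp add: transcendental_entire_def)
  have "\<exists>z. norm (f z) > 1"
  proof (rule ccontr)
    assume "\<not> ?thesis"
    then have "bounded (range f)" by (auto simp: bounded_iff not_less)
    with hol have "f constant_on UNIV" by (rule Liouville_theorem)
    then obtain c where "\<And>z. f z = c" by (auto simp: constant_on_def)
    then have "\<forall>z. f z = poly [:c:] z" by simp
    with assms show False unfolding transcendental_entire_def by blast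
  qed
  then obtain z where "norm (f z) > 1" by blast
  then show ?thesis
    using norm_le_max_modulus[OF hol, of z]
    by (auto simp: eventually_at_top_linorder intro!: exI[of _ "norm z"] intro: less_le_trans)
qed

text \<open>Pick p below the lower order and L above the order, then exponentiate twice. Enlarging L
  to at least 1 secures R \<le> R powr L for R \<ge> 1 later.\<close>

lemma growth_bounds:
  assumes "transcendental_entire f" "0 < lower_growth_order f" "growth_order f < \<infinity>"
  obtains L p where "1 \<le> L" "0 < p"
    "eventually (\<lambda>r. max_modulus r f \<le> exp (r powr L)) at_top"
    "eventually (\<lambda>r. exp (r powr p) \<le> max_modulus r f) at_top"
proof -
  obtain p where p: "0 < ereal p" "ereal p < lower_growth_order f"
    using ereal_dense2[OF assms(2)] by blast
  obtain L' where L': "growth_order f < ereal L'"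
    using ereal_dense2[OF assms(3)] by blast
  define L where "L = max 1 L'"
  have L: "growth_order f < ereal L" using L' by (rule less_le_trans) (simp add: L_def)
  have p': "eventually (\<lambda>r. p < ln (ln (max_modulus r f)) / ln r) at_top"
    using less_LiminfD[OF p(2)[unfolded lower_growth_order_def]] by simp
  have L'': "eventually (\<lambda>r. ln (ln (max_modulus r f)) / ln r < L) at_top"
    using Limsup_lessD[OF L[unfolded growth_order_def]] by simp
  show thesis
  proof (rule that)
    show "eventually (\<lambda>r. max_modulus r f \<le> exp (r powr L)) at_top"
      using L'' eventually_max_modulus_gt_1[OF assms(1)] eventually_gt_at_top[of 1]
    proof eventually_elim
      case (elim r)
      then have "ln (ln (max_modulus r f)) < L * ln r" by (simp add: field_simps)
      then have "exp (ln (ln (max_modulus r f))) < exp (L * ln r)" by simp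
      then have "ln (max_modulus r f) \<le> r powr L" using elim by (simp add: powr_def)
      then have "exp (ln (max_modulus r f)) \<le> exp (r powr L)" by simp
      with elim show ?case by simp
    qed
    show "eventually (\<lambda>r. exp (r powr p) \<le> max_modulus r f) at_top"
      using p' eventually_max_modulus_gt_1[OF assms(1)] eventually_gt_at_top[of 1]
    proof eventually_elim
      case (elim r)
      then have "p * ln r < ln (ln (max_modulus r f))" by (simp add: field_simps)
      then have "exp (p * ln r) < exp (ln (ln (max_modulus r f)))" by simp
      then have "r powr p \<le> ln (max_modulus r f)" using elim by (simp add: powr_def)
      then have "exp (r powr p) \<le> exp (ln (max_modulus r f))" by simp
      with elim show ?case by simp
    qed
  qed (use p in \<open>auto simp: L_def\<close>)
qed

text \<open>If the whole interval from R powr \<delta> to R were exceptional, the exceptional set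
  would have logarithmic measure at least (1 - \<delta>) ln R below R, against its upper density. A
  radius outside the set has ln m > \<epsilon> ln M.\<close>

lemma good_radii:
  assumes "f \<in> class_Delta"
  obtains \<epsilon> \<delta> :: real where "0 < \<epsilon>" "0 < \<delta>"
    "eventually (\<lambda>R. \<exists>r. R powr \<delta> < r \<and> r < R \<and> max_modulus r f powr \<epsilon> \<le> min_modulus r f) at_top"
proof -
  from assms obtain \<epsilon>\<^sub>1 \<epsilon> :: real where eps: "\<epsilon>\<^sub>1 < 1" "0 < \<epsilon>" "0 < \<epsilon>\<^sub>1"
      and dens: "upper_log_density (small_min_modulus_set \<epsilon> f) \<le> ereal \<epsilon>\<^sub>1"
      and tr: "transcendental_entire f"
    by (auto simp: class_Delta_def)
  have cont: "continuous_on UNIV f"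
    using tr by (auto simp: transcendental_entire_def intro: holomorphic_on_imp_continuous_on)
  define E where "E = small_min_modulus_set \<epsilon> f"
  have E: "E \<in> sets borel" unfolding E_def by (rule sets_small_min_modulus_set[OF cont])
  \<comment> \<open>This choice leaves a gap between the density bound
    \<open>\<epsilon>\<^sub>1\<close> and 1 - \<delta>, the logarithmic proportion of the
    interval.\<close>
  define \<delta> where "\<delta> = (1 - \<epsilon>\<^sub>1) / 3"
  have \<delta>: "0 < \<delta>" "\<delta> < 1" "\<epsilon>\<^sub>1 < 1 - \<delta>" using eps by (auto simp: \<delta>_def field_simps)
  have "upper_log_density E < ereal (1 - \<delta>)"
    using dens \<delta> unfolding E_def by (meson ereal_less_le le_less_trans less_ereal.simps(1))
  then have ev: "eventually (\<lambda>R. 1 / ln R * (LINT t:E \<inter> {1<..<R}|lebesgue. 1 / t) < 1 - \<delta>) at_top"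
    unfolding upper_log_density_def by (drule_tac Limsup_lessD) simp
  obtain r0 where r0: "\<And>r. r0 \<le> r \<Longrightarrow> 1 < max_modulus r f"
    using eventually_max_modulus_gt_1[OF tr] by (auto simp: eventually_at_top_linorder)
  \<comment> \<open>This ensures M(r) > 1 for every r above R powr \<delta>, so
    \<open>log_ext\<close> is the ordinary logarithm at M(r).\<close>
  have lim: "eventually (\<lambda>R. r0 \<le> R powr \<delta>) at_top"
    using \<delta>(1) by (intro filterlim_at_top[THEN iffD1, rule_format] ) real_asymp
  have "eventually (\<lambda>R. \<exists>r. R powr \<delta> < r \<and> r < R \<and> max_modulus r f powr \<epsilon> \<le> min_modulus r f) at_top"
    using ev lim eventually_gt_at_top[of 1]
  proof eventually_elim
    case (elim R)
    have a1: "1 < R powr \<delta>" "R powr \<delta> < R" using elim \<delta> powr_less_mono[of \<delta> 1 R] by auto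
    define a where "a = R powr \<delta>"
    have lna: "ln a = \<delta> * ln R" using elim by (simp add: a_def ln_powr)
    have "\<not> {a<..<R} \<subseteq> E"
    proof
      assume sub: "{a<..<R} \<subseteq> E"
      have int: "set_integrable lebesgue {u<..<v} (\<lambda>t::real. 1 / t)"
        and val: "(LINT t:{u<..<v}|lebesgue. 1 / t) = ln v - ln u" if "1 \<le> u" "u \<le> v" for u v :: real
      proof -
        have "continuous_on {u..v} (\<lambda>t::real. 1 / t)"
          using that by (intro continuous_intros) auto
        from set_integrable_subset[OF absolutely_integrable_continuous_real[OF this]]
        show int: "set_integrable lebesgue {u<..<v} (\<lambda>t::real. 1 / t)"
          by (metis greaterThanLessThan_subseteq_atLeastAtMost_iff lmeasurable_interval(2) fmeasurableD order_refl)
        have "((\<lambda>t. 1 / t) has_integral ln v - ln u) {u..v}"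
          using that by (intro fundamental_theorem_of_calculus)
            (auto intro!: derivative_eq_intros simp flip: has_real_derivative_iff_has_vector_derivative)
        then have "integral {u<..<v} (\<lambda>t. 1 / t) = ln v - ln u"
          by (simp add: has_integral_Icc_iff_Ioo integral_unique)
        then show "(LINT t:{u<..<v}|lebesgue. 1 / t) = ln v - ln u"
          using set_lebesgue_integral_eq_integral(2)[OF int] by simp
      qed
      have intE: "set_integrable lebesgue (E \<inter> {1<..<R}) (\<lambda>t::real. 1 / t)"
        by (rule set_integrable_subset[OF int[of 1 R]]) (use E elim in auto)
      have "(1 - \<delta>) * ln R = (LINT t:{a<..<R}|lebesgue. 1 / t)"
        using val[of a R] a1 lna by (simp add: a_def algebra_simps)
      also have "\<dots> \<le> (LINT t:E \<inter> {1<..<R}|lebesgue. 1 / t)"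
        unfolding set_lebesgue_integral_def
        by (intro integral_mono int[unfolded set_integrable_def] intE[unfolded set_integrable_def])
           (use sub a1 in \<open>auto simp: indicator_def a_def subset_iff split: if_splits\<close>)
      also have "\<dots> < (1 - \<delta>) * ln R"
        using elim by (simp add: field_simps)
      finally show False by simp
    qed
    then obtain r where r: "a < r" "r < R" "r \<notin> E" by (meson greaterThanLessThan_iff subsetI)
    then have r1: "1 < r" and "1 < max_modulus r f"
      using a1 elim r0[of r] by (auto simp: a_def)
    with r have "\<not> log_ext (min_modulus r f) \<le> ereal (\<epsilon> * ln (max_modulus r f))"
      by (auto simp: E_def small_min_modulus_set_def log_ext_def[of "max_modulus r f"])
    \<comment> \<open>A vanishing minimum modulus has extended logarithm minus infinity and would
      put r into \<open>E\<close>; so r outside \<open>E\<close> yields positivity as well.\<close>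
    then have "0 < min_modulus r f" "\<epsilon> * ln (max_modulus r f) < ln (min_modulus r f)"
      by (auto simp: log_ext_def split: if_splits)
    then have "exp (\<epsilon> * ln (max_modulus r f)) < min_modulus r f"
      by (metis exp_less_cancel_iff exp_ln)
    then show ?case using r \<open>1 < max_modulus r f\<close> by (intro exI[of _ r]) (auto simp: a_def powr_def)
  qed
  with eps \<delta> that show thesis by blast
qed

subsection \<open>Comparison of iterates on Fatou components\<close>

text \<open>Harnack's inequality for the positive harmonic function \<open>Re h\<close>: the Schwarz lemma applied to
  \<open>(h - h b) / (h + cnj (h b))\<close>.\<close>
lemma Harnack_Re:
  assumes hol: "h holomorphic_on ball b \<rho>" and pos: "\<And>x. x \<in> ball b \<rho> \<Longrightarrow> 0 < Re (h x)"
    and "0 < \<rho>" and x: "dist b x \<le> \<rho> / 2"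
  shows "Re (h x) \<le> 3 * Re (h b)"
proof -
  define H where "H = (\<lambda>\<zeta>. h (b + of_real \<rho> * \<zeta>))"
  define \<phi> where "\<phi> = (\<lambda>\<zeta>. (H \<zeta> - h b) / (H \<zeta> + cnj (h b)))"
  have inb: "b + of_real \<rho> * \<zeta> \<in> ball b \<rho>" if "norm \<zeta> < 1" for \<zeta>
    using that \<open>0 < \<rho>\<close> by (auto simp: dist_norm norm_mult)
  have Hpos: "0 < Re (H \<zeta>)" if "norm \<zeta> < 1" for \<zeta>
    unfolding H_def using pos inb[OF that] by blast
  have b0: "0 < Re (h b)" using pos[of b] \<open>0 < \<rho>\<close> by auto
  have nz: "H \<zeta> + cnj (h b) \<noteq> 0" if "norm \<zeta> < 1" for \<zeta>
    using Hpos[OF that] b0 by (auto simp: complex_eq_iff)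
  have Hhol: "H holomorphic_on ball 0 1"
    unfolding H_def
    by (rule holomorphic_on_compose_gen[OF _ hol, unfolded o_def])
       (use inb in \<open>auto intro!: holomorphic_intros\<close>)
  \<comment> \<open>The identity serves twice: it shows that \<phi> maps the unit disc into itself,
    and it turns the Schwarz bound into a quadratic inequality between real parts.\<close>
  have sq: "(norm (H \<zeta> - h b))\<^sup>2 = (norm (H \<zeta> + cnj (h b)))\<^sup>2 - 4 * Re (H \<zeta>) * Re (h b)" for \<zeta>
    unfolding cmod_power2 by (simp add: power2_eq_square algebra_simps)
  have lt1: "norm (\<phi> \<zeta>) < 1" if "norm \<zeta> < 1" for \<zeta>
  proof -
    have "(norm (H \<zeta> - h b))\<^sup>2 < (norm (H \<zeta> + cnj (h b)))\<^sup>2"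
      using sq[of \<zeta>] Hpos[OF that] b0 by simp
    then have "norm (H \<zeta> - h b) < norm (H \<zeta> + cnj (h b))"
      by (rule power_less_imp_less_base) simp
    then show ?thesis using nz[OF that] by (simp add: \<phi>_def norm_divide)
  qed
  define \<zeta> where "\<zeta> = (x - b) / of_real \<rho>"
  have \<zeta>: "norm \<zeta> \<le> 1 / 2" "H \<zeta> = h x"
    using x \<open>0 < \<rho>\<close> by (auto simp: \<zeta>_def H_def norm_divide dist_norm norm_minus_commute field_simps)
  have "norm (\<phi> \<zeta>) \<le> norm \<zeta>"
  proof (rule Schwarz_Lemma(1))
    show "\<phi> holomorphic_on ball 0 1"
      unfolding \<phi>_def by (intro holomorphic_intros Hhol) (use nz in auto)
  qed (use lt1 \<zeta> in \<open>auto simp: \<phi>_def H_def\<close>)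
  then have "norm (\<phi> \<zeta>) \<le> 1 / 2" using \<zeta> by simp
  then have "norm (H \<zeta> - h b) \<le> norm (H \<zeta> + cnj (h b)) / 2"
    using nz[of \<zeta>] \<zeta> by (simp add: \<phi>_def norm_divide field_simps)
  then have "(norm (H \<zeta> - h b))\<^sup>2 \<le> (norm (H \<zeta> + cnj (h b)) / 2)\<^sup>2"
    by (rule power_mono) simp
  then have "3 * (norm (H \<zeta> - h b))\<^sup>2 \<le> 4 * Re (H \<zeta>) * Re (h b)"
    using sq[of \<zeta>] by (simp add: power_divide)
  moreover have "(Re (H \<zeta>) - Re (h b))\<^sup>2 \<le> (norm (H \<zeta> - h b))\<^sup>2"
    by (simp add: cmod_power2)
  ultimately have "3 * (Re (h x) - Re (h b))\<^sup>2 \<le> 4 * Re (h x) * Re (h b)"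
    using \<zeta> by simp
  \<comment> \<open>With A = Re (h x) and B = Re (h b), 3 (A - B)^2 - 4 A B factors as (3 A - B)(A -
    3 B). If A > 3 B, both factors would be positive.\<close>
  then have *: "(3 * Re (h x) - Re (h b)) * (Re (h x) - 3 * Re (h b)) \<le> 0"
    by (simp add: power2_eq_square algebra_simps)
  show ?thesis
  proof (rule ccontr)
    assume "\<not> ?thesis"
    then have "0 < (3 * Re (h x) - Re (h b)) * (Re (h x) - 3 * Re (h b))"
      using b0 by (intro mult_pos_pos) auto
    with * show False by simp
  qed
qed

text \<open>A zero-free g on a ball has a holomorphic logarithm, whose real part ln |g| is positive
  because |g| > 1.\<close>

lemma Harnack_ln_norm:
  assumes hol: "g holomorphic_on ball b \<rho>" and gt: "\<And>x. x \<in> ball b \<rho> \<Longrightarrow> 1 < norm (g x)"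
    and "0 < \<rho>" and x: "dist b x \<le> \<rho> / 2"
  shows "ln (norm (g x)) \<le> 3 * ln (norm (g b))"
proof -
  have nz: "g z \<noteq> 0" if "z \<in> ball b \<rho>" for z using gt[OF that] by auto
  obtain h where h: "h holomorphic_on ball b \<rho>" "\<And>z. z \<in> ball b \<rho> \<Longrightarrow> g z = exp (h z)"
    using contractible_imp_holomorphic_log[OF hol convex_imp_contractible[OF convex_ball] nz] by blast
  have ln: "ln (norm (g z)) = Re (h z)" if "z \<in> ball b \<rho>" for z
    using h(2)[OF that] by simp
  have "Re (h x) \<le> 3 * Re (h b)"
  proof (rule Harnack_Re[OF h(1) _ assms(3,4)])
    fix z assume "z \<in> ball b \<rho>"
    with gt[OF this] ln[OF this] show "0 < Re (h z)" by (metis ln_gt_zero)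
  qed
  with ln[of x] ln[of b] x \<open>0 < \<rho>\<close> show ?thesis by simp
qed

text \<open>Truncation at \<open>exp 1\<close> makes the logarithmic size at least 1, so that multiplicative comparison
  of two values also covers bounded limits, not only escape to infinity.\<close>
definition tlog :: "complex \<Rightarrow> real" where
  "tlog w = ln (max (exp 1) (norm w))"

lemma tlog_ge_1: "1 \<le> tlog w"
  unfolding tlog_def by (subst ln_ge_iff) (auto simp: less_max_iff_disj)

lemma tlog_mono: "norm w \<le> B \<Longrightarrow> tlog w \<le> ln (max (exp 1) B)"
  unfolding tlog_def by (subst ln_le_cancel_iff) (auto simp: less_max_iff_disj)

lemma ln_norm_le_tlog: "0 < norm w \<Longrightarrow> ln (norm w) \<le> tlog w"
  unfolding tlog_def by (subst ln_le_cancel_iff) (auto simp: less_max_iff_disj)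

section \<open>Truncated logarithms on normal families and along iterates\<close>

lemma normal_family_on_subseq:
  fixes g :: "nat \<Rightarrow> complex \<Rightarrow> complex"
  assumes "normal_family_on F U" "range g \<subseteq> F"
  obtains s where "strict_mono s"
    "(\<exists>h. h holomorphic_on U \<and>
        (\<forall>K. compact K \<and> K \<subseteq> U \<longrightarrow> uniform_limit K (\<lambda>k. g (s k)) h sequentially))
     \<or> (\<forall>K. compact K \<and> K \<subseteq> U \<longrightarrow>
          (\<forall>B. \<forall>\<^sub>F k in sequentially. \<forall>z\<in>K. B < norm (g (s k) z)))"
proof -
  note * = assms(1)[unfolded normal_family_on_def, THEN spec, THEN mp, OF assms(2)]
  show thesis
    by (rule exE[OF *], erule conjE, rule that)
qed

text \<open>Otherwise some members of the family and pairs of points have ratios of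
  \<open>tlog\<close> tending to infinity. A subsequence converges or escapes, and either
  alternative bounds these ratios: by boundedness of the limit, or by Harnack's inequality.\<close>

lemma normal_family_tlog_comparable:
  assumes "normal_family_on F U" "open U" "z \<in> U" and hol: "\<And>g. g \<in> F \<Longrightarrow> g holomorphic_on U"
  obtains r K where "0 < r" "ball z r \<subseteq> U" "0 < K"
    "\<And>g a b. \<lbrakk>g \<in> F; a \<in> ball z r; b \<in> ball z r\<rbrakk> \<Longrightarrow> tlog (g a) \<le> K * tlog (g b)"
proof -
  obtain e where e: "0 < e" "cball z e \<subseteq> U" using assms open_contains_cball by blast
  \<comment> \<open>For a and b in the ball of radius r about z, the ball of radius 4 r about b
    stays within distance 5 r = e of z, and dist b a < 2 r is half of 4 r, as Harnack's inequality
    requires.\<close>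
  define r where "r = e / 5"
  have r: "0 < r" using e by (simp add: r_def)
  have sub: "ball z r \<subseteq> cball z e" using r by (auto simp: r_def)
  have ex: "\<exists>K>0. \<forall>g\<in>F. \<forall>a\<in>ball z r. \<forall>b\<in>ball z r. tlog (g a) \<le> K * tlog (g b)"
  proof (rule ccontr)
    assume "\<not> ?thesis"
    then have no: "\<exists>g\<in>F. \<exists>a\<in>ball z r. \<exists>b\<in>ball z r. K * tlog (g b) < tlog (g a)" if "0 < K" for K
      using that unfolding not_le[symmetric] by blast
    have "\<forall>j::nat. \<exists>g a b. g \<in> F \<and> a \<in> ball z r \<and> b \<in> ball z r \<and> real (Suc j) * tlog (g b) < tlog (g a)"
      using no[of "real (Suc j)" for j] by fastforce
    then have "\<exists>g a b. \<forall>j::nat. g j \<in> F \<and> a j \<in> ball z r \<and> b j \<in> ball z r \<and>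
        real (Suc j) * tlog (g j (b j)) < tlog (g j (a j))"
      by (simp only: choice_iff)
    then obtain g a b where gab: "\<And>j::nat. g j \<in> F" "\<And>j. a j \<in> ball z r" "\<And>j. b j \<in> ball z r"
      "\<And>j. real (Suc j) * tlog (g j (b j)) < tlog (g j (a j))" by blast
    have ran: "range g \<subseteq> F" using gab by auto
    obtain s where s: "strict_mono s" and
      alt: "(\<exists>h. h holomorphic_on U \<and>
               (\<forall>K. compact K \<and> K \<subseteq> U \<longrightarrow> uniform_limit K (\<lambda>k. g (s k)) h sequentially))
            \<or> (\<forall>K. compact K \<and> K \<subseteq> U \<longrightarrow>
                 (\<forall>B. \<forall>\<^sub>F k in sequentially. \<forall>z\<in>K. B < norm (g (s k) z)))"
      by (rule normal_family_on_subseq[OF assms(1) ran])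
    have "\<exists>M::real. \<forall>\<^sub>F k in sequentially. tlog (g (s k) (a (s k))) \<le> M * tlog (g (s k) (b (s k)))"
      using alt
    proof
      assume "\<exists>h. h holomorphic_on U \<and>
               (\<forall>K. compact K \<and> K \<subseteq> U \<longrightarrow> uniform_limit K (\<lambda>k. g (s k)) h sequentially)"
      then obtain h where h: "h holomorphic_on U" and
        unif: "\<forall>K. compact K \<and> K \<subseteq> U \<longrightarrow> uniform_limit K (\<lambda>k. g (s k)) h sequentially"
        by (elim exE conjE)
      have lim: "uniform_limit (cball z e) (\<lambda>k. g (s k)) h sequentially"
        by (rule unif[rule_format]) (use e in auto)
      have "compact (h ` cball z e)"
        using h e by (intro compact_continuous_image holomorphic_on_imp_continuous_on holomorphic_on_subset[OF h]) auto
      then obtain B where B: "\<And>x. x \<in> cball z e \<Longrightarrow> norm (h x) \<le> B"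
        using compact_imp_bounded bounded_iff by (metis imageI)
      have "\<forall>\<^sub>F k in sequentially. \<forall>x\<in>cball z e. dist (g (s k) x) (h x) < 1"
        using lim zero_less_one unfolding uniform_limit_iff by blast
      then have "\<forall>\<^sub>F k in sequentially. tlog (g (s k) (a (s k))) \<le> ln (max (exp 1) (B + 1)) * tlog (g (s k) (b (s k)))"
      proof eventually_elim
        case (elim k)
        have C: "0 \<le> ln (max (exp 1) (B + 1))"
          by (intro ln_ge_zero) (simp add: le_max_iff_disj)
        have ain: "a (s k) \<in> cball z e" using gab(2) sub by blast
        have "norm (g (s k) (a (s k))) \<le> norm (h (a (s k))) + dist (g (s k) (a (s k))) (h (a (s k)))"
          by (simp add: dist_norm norm_triangle_sub)
        also have "\<dots> \<le> B + 1" using elim[rule_format, OF ain] B[OF ain] by simp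
        finally have "tlog (g (s k) (a (s k))) \<le> ln (max (exp 1) (B + 1))" by (rule tlog_mono)
        \<comment> \<open>Truncation enters here: the factor \<open>tlog\<close> at b is at least 1,
          however small the value of the function at b.\<close>
        also have "\<dots> \<le> ln (max (exp 1) (B + 1)) * tlog (g (s k) (b (s k)))"
          using mult_left_mono[OF tlog_ge_1 C] by simp
        finally show ?case .
      qed
      then show ?thesis by (rule exI)
    next
      \<comment> \<open>In the escaping case the values on the closed ball eventually exceed
        \<open>exp 1\<close> in modulus, so truncation has no effect and Harnack's inequality gives
        the factor 3.\<close>
      assume esc: "\<forall>K. compact K \<and> K \<subseteq> U \<longrightarrow>
                 (\<forall>B :: real. \<forall>\<^sub>F k in sequentially. \<forall>z\<in>K. B < norm (g (s k) z))"
      have "\<forall>\<^sub>F k in sequentially. \<forall>x\<in>cball z e. exp 1 < norm (g (s k) x)"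
        by (rule esc[rule_format]) (use e in auto)
      then have "\<forall>\<^sub>F k in sequentially. tlog (g (s k) (a (s k))) \<le> 3 * tlog (g (s k) (b (s k)))"
      proof eventually_elim
        case (elim k)
        let ?a = "a (s k)" and ?b = "b (s k)"
        have ab: "dist z ?a < r" "dist z ?b < r" using gab by auto
        have bsub: "ball ?b (4 * r) \<subseteq> cball z e"
        proof
          fix x assume "x \<in> ball ?b (4 * r)"
          with ab show "x \<in> cball z e"
            using dist_triangle[of z x ?b] by (simp add: r_def)
        qed
        have gt: "1 < norm (g (s k) x)" if "x \<in> cball z e" for x
          using elim[rule_format, OF that] one_less_exp_iff[of "1::real"] by linarith
        have "ln (norm (g (s k) ?a)) \<le> 3 * ln (norm (g (s k) ?b))"
        proof (rule Harnack_ln_norm[where g = "g (s k)"])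
          show "g (s k) holomorphic_on ball ?b (4 * r)"
            using bsub e by (intro holomorphic_on_subset[OF hol[OF gab(1)]]) auto
          show "dist ?b ?a \<le> 4 * r / 2" using ab dist_triangle[of ?b ?a z] by (simp add: dist_commute)
        qed (use bsub gt r in auto)
        moreover have "tlog (g (s k) x) = ln (norm (g (s k) x))" if "x \<in> cball z e" for x
          using elim[rule_format, OF that] by (simp add: tlog_def max_def)
        ultimately show ?case using gab(2,3) sub by (metis subsetD)
      qed
      then show ?thesis by (rule exI)
    qed
    then obtain M :: real where M: "\<forall>\<^sub>F k in sequentially. tlog (g (s k) (a (s k))) \<le> M * tlog (g (s k) (b (s k)))"
      by blast
    have "\<forall>\<^sub>F k in sequentially. M \<le> real k"
      by (rule eventually_sequentiallyI[of "nat \<lceil>M\<rceil>"]) linarith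
    with M have "\<forall>\<^sub>F k in sequentially. False"
    proof eventually_elim
      case (elim k)
      \<comment> \<open>A strictly increasing \<open>s\<close> satisfies k \<le> s k, so the ratios
        forced by the choice of a and b overtake any fixed M.\<close>
      have "M \<le> real (Suc (s k))" using elim strict_mono_imp_increasing[OF s, of k] by simp
      then have "M * tlog (g (s k) (b (s k))) \<le> real (Suc (s k)) * tlog (g (s k) (b (s k)))"
        using tlog_ge_1[of "g (s k) (b (s k))"] by (intro mult_right_mono) auto
      with elim gab(4)[of "s k"] show False by linarith
    qed
    then show False by simp
  qed
  from ex obtain K where K: "0 < K" "\<And>g a b. \<lbrakk>g \<in> F; a \<in> ball z r; b \<in> ball z r\<rbrakk> \<Longrightarrow> tlog (g a) \<le> K * tlog (g b)"
    by blast
  show thesis using r _ K by (rule that) (use sub e in auto)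
qed

lemma holomorphic_funpow:
  fixes f :: "complex \<Rightarrow> complex"
  assumes "f holomorphic_on UNIV"
  shows "(f ^^ n) holomorphic_on UNIV"
proof (induction n)
  case (Suc n)
  then show ?case
    using holomorphic_on_compose_gen[OF Suc assms] by (simp add: o_def)
qed (simp add: id_def)

lemma open_Fatou_set: "open (Fatou_set f)"
  by (subst open_subopen) (unfold Fatou_set_def, blast)

text \<open>Two-sided comparability with a constant independent of n is an equivalence relation with
  open classes, so it relates all points of a connected set. Finitely many of the local balls cover
  T and give one constant.\<close>

lemma Fatou_tlog_comparable:
  assumes hol: "f holomorphic_on UNIV" and S: "connected S" "S \<subseteq> Fatou_set f"
    and T: "compact T" "T \<subseteq> S" and w: "w \<in> S"
  obtains K where "\<And>n x. \<lbrakk>1 \<le> n; x \<in> T\<rbrakk> \<Longrightarrow> tlog ((f ^^ n) x) \<le> K * tlog ((f ^^ n) w)"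
proof -
  define F where "F = {f ^^ n | n. 1 \<le> n}"
  have loc: "\<exists>r K. 0 < r \<and> 0 < K \<and> (\<forall>n\<ge>1. \<forall>a\<in>ball z r. \<forall>b\<in>ball z r. tlog ((f ^^ n) a) \<le> K * tlog ((f ^^ n) b))"
    if "z \<in> S" for z
  proof -
    have "z \<in> Fatou_set f" using that S by blast
    then obtain U where U: "open U" "z \<in> U" "normal_family_on F U"
      unfolding Fatou_set_def F_def by blast
    have "g holomorphic_on U" if "g \<in> F" for g
      using that holomorphic_funpow[OF hol] by (auto simp: F_def intro: holomorphic_on_subset)
    from normal_family_tlog_comparable[OF U(3,1,2) this] obtain r K where
      "0 < r" "0 < K" "\<And>g a b. \<lbrakk>g \<in> F; a \<in> ball z r; b \<in> ball z r\<rbrakk> \<Longrightarrow> tlog (g a) \<le> K * tlog (g b)"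
      by metis
    then show ?thesis unfolding F_def by blast
  qed
  define R where "R = (\<lambda>x y. \<exists>K>0. \<forall>n\<ge>1. tlog ((f ^^ n) x) \<le> K * tlog ((f ^^ n) y) \<and>
    tlog ((f ^^ n) y) \<le> K * tlog ((f ^^ n) x))"
  have Rall: "R x y" if "x \<in> S" "y \<in> S" for x y
  proof (rule connected_equivalence_relation[OF S(1) that])
    show "R y x" if "R x y" for x y using that unfolding R_def by blast
    show "R x z" if Rxy: "R x y" and Ryz: "R y z" for x y z
    proof -
      have chain: "tlog a \<le> K * K' * tlog c"
        if "tlog a \<le> K * tlog b" "tlog b \<le> K' * tlog c" "0 < K" for a b c K K'
        using order_trans[OF that(1) mult_left_mono[OF that(2), of K]] that(3) by (simp add: mult.assoc)
      from Rxy obtain K where K: "0 < K" "\<forall>n\<ge>1. tlog ((f ^^ n) x) \<le> K * tlog ((f ^^ n) y) \<and>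
        tlog ((f ^^ n) y) \<le> K * tlog ((f ^^ n) x)" unfolding R_def by blast
      from Ryz obtain K' where K': "0 < K'" "\<forall>n\<ge>1. tlog ((f ^^ n) y) \<le> K' * tlog ((f ^^ n) z) \<and>
        tlog ((f ^^ n) z) \<le> K' * tlog ((f ^^ n) y)" unfolding R_def by blast
      have "\<forall>n\<ge>1. tlog ((f ^^ n) x) \<le> K * K' * tlog ((f ^^ n) z) \<and>
          tlog ((f ^^ n) z) \<le> K' * K * tlog ((f ^^ n) x)"
        using K K' chain by blast
      then show "R x z"
        unfolding R_def using K(1) K'(1) by (intro exI[of _ "K * K'"]) (auto simp: mult.commute[of K' K])
    qed
    fix a assume a: "a \<in> S"
    from loc[OF a] obtain r K where r: "0 < r" "0 < K"
      "\<forall>n\<ge>1. \<forall>x\<in>ball a r. \<forall>b\<in>ball a r. tlog ((f ^^ n) x) \<le> K * tlog ((f ^^ n) b)" by blast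
    show "\<exists>T. openin (top_of_set S) T \<and> a \<in> T \<and> (\<forall>x\<in>T. R a x)"
    proof (intro exI[of _ "S \<inter> ball a r"] conjI ballI)
      fix x assume "x \<in> S \<inter> ball a r"
      then show "R a x" unfolding R_def using r by (intro exI[of _ K]) auto
    qed (use a r in \<open>auto simp: openin_open_Int\<close>)
  qed
  have unif: "\<exists>r K. 0 < r \<and> (\<forall>n\<ge>1. \<forall>x\<in>ball z r. tlog ((f ^^ n) x) \<le> K * tlog ((f ^^ n) w))" if "z \<in> T" for z
  proof -
    have z: "z \<in> S" using that T by blast
    from loc[OF z] obtain r K where r: "0 < r" "0 < K"
      "\<forall>n\<ge>1. \<forall>x\<in>ball z r. \<forall>b\<in>ball z r. tlog ((f ^^ n) x) \<le> K * tlog ((f ^^ n) b)" by blast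
    from Rall[OF z w] obtain K' where K': "\<forall>n\<ge>1. tlog ((f ^^ n) z) \<le> K' * tlog ((f ^^ n) w)"
      unfolding R_def by blast
    have "tlog ((f ^^ n) x) \<le> (K * K') * tlog ((f ^^ n) w)" if "1 \<le> n" "x \<in> ball z r" for n x
    proof -
      have "tlog ((f ^^ n) x) \<le> K * tlog ((f ^^ n) z)" using r that by auto
      also have "\<dots> \<le> K * (K' * tlog ((f ^^ n) w))"
        using K' that r(2) by (intro mult_left_mono) auto
      finally show ?thesis by (simp add: mult.assoc)
    qed
    with r show ?thesis by blast
  qed
  then obtain r K where rK: "\<And>z. z \<in> T \<Longrightarrow> 0 < r z"
    "\<And>z n x. \<lbrakk>z \<in> T; 1 \<le> n; x \<in> ball z (r z)\<rbrakk> \<Longrightarrow> tlog ((f ^^ n) x) \<le> K z * tlog ((f ^^ n) w)"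
    by metis
  have "T \<subseteq> (\<Union>z\<in>T. ball z (r z))" using rK(1) by force
  then obtain D where D: "D \<subseteq> T" "finite D" "T \<subseteq> (\<Union>z\<in>D. ball z (r z))"
    using compactE_image[OF T(1), of T "\<lambda>z. ball z (r z)"] by blast
  show thesis
  proof (rule that)
    fix n :: nat and x assume n: "1 \<le> n" "x \<in> T"
    then obtain z where z: "z \<in> D" "x \<in> ball z (r z)" using D by blast
    have "tlog ((f ^^ n) x) \<le> K z * tlog ((f ^^ n) w)" using rK(2) z n D by blast
    \<comment> \<open>The sum of absolute values dominates every \<open>K z\<close> without
      information on signs, and also makes sense for empty D.\<close>
    also have "\<dots> \<le> (\<Sum>z\<in>D. \<bar>K z\<bar>) * tlog ((f ^^ n) w)"
    proof (intro mult_right_mono)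
      have "\<bar>K z\<bar> \<le> (\<Sum>z\<in>D. \<bar>K z\<bar>)" by (intro member_le_sum) (use D z in auto)
      then show "K z \<le> (\<Sum>z\<in>D. \<bar>K z\<bar>)" by linarith
    qed (use tlog_ge_1[of "(f ^^ n) w"] in auto)
    finally show "tlog ((f ^^ n) x) \<le> (\<Sum>z\<in>D. \<bar>K z\<bar>) * tlog ((f ^^ n) w)" .
  qed
qed

subsection \<open>Long continua\<close>

text \<open>The moduli of the points of a connected set form an interval.\<close>

lemma connected_meets_sphere:
  fixes \<gamma> :: "complex set"
  assumes "connected \<gamma>" "w \<in> \<gamma>" "z \<in> \<gamma>" "norm w \<le> r" "r \<le> norm z"
  obtains \<zeta> where "\<zeta> \<in> \<gamma>" "norm \<zeta> = r"
proof -
  have "connected (norm ` \<gamma>)" by (intro connected_continuous_image continuous_intros assms)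
  then have "r \<in> norm ` \<gamma>" using connectedD_interval[of "norm ` \<gamma>" "norm w" "norm z" r] assms by auto
  with that show thesis by auto
qed

text \<open>The conclusion has the shape of the hypothesis, with the image of \<gamma> for \<gamma>
  and exp (R powr L) for R. Put S = exp (R powr (L + 1)). A good radius r between S powr \<delta>
  and S gives a point of \<gamma> where |f| is at least exp (\<epsilon> * r powr p).\<close>

lemma long_continuum_image:
  assumes "f \<in> class_Delta" "0 < lower_growth_order f" "growth_order f < \<infinity>"
  obtains L R0 where "1 \<le> L" "1 \<le> R0"
    "\<And>R \<gamma> w z. \<lbrakk>R0 \<le> R; connected \<gamma>; w \<in> \<gamma>; z \<in> \<gamma>; norm w \<le> R; exp (R powr (L + 1)) \<le> norm z\<rbrakk>
      \<Longrightarrow> norm (f w) \<le> exp (R powr L) \<and> (\<exists>\<zeta>\<in>\<gamma>. exp (exp (R powr L) powr (L + 1)) \<le> norm (f \<zeta>))"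
proof -
  have tr: "transcendental_entire f" using assms(1) by (simp add: class_Delta_def)
  then have hol: "f holomorphic_on UNIV" by (simp add: transcendental_entire_def)
  obtain L p where Lp: "1 \<le> L" "0 < p"
    and up: "eventually (\<lambda>r. max_modulus r f \<le> exp (r powr L)) at_top"
    and lo: "eventually (\<lambda>r. exp (r powr p) \<le> max_modulus r f) at_top"
    using growth_bounds[OF tr assms(2,3)] by blast
  obtain \<epsilon> \<delta> :: real where ed: "0 < \<epsilon>" "0 < \<delta>" and good:
    "eventually (\<lambda>R. \<exists>r. R powr \<delta> < r \<and> r < R \<and> max_modulus r f powr \<epsilon> \<le> min_modulus r f) at_top"
    using good_radii[OF assms(1)] by blast
  obtain u where u: "\<And>r. u \<le> r \<Longrightarrow> max_modulus r f \<le> exp (r powr L)"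
    using up by (auto simp: eventually_at_top_linorder)
  obtain l where l: "\<And>r. l \<le> r \<Longrightarrow> exp (r powr p) \<le> max_modulus r f"
    using lo by (auto simp: eventually_at_top_linorder)
  obtain g where g: "\<And>R. g \<le> R \<Longrightarrow> \<exists>r. R powr \<delta> < r \<and> r < R \<and> max_modulus r f powr \<epsilon> \<le> min_modulus r f"
    using good by (auto simp: eventually_at_top_linorder)
  \<comment> \<open>Beyond the thresholds u, l, g of the asymptotic bounds, 1 / \<delta> gives
    \<delta> R \<ge> 1, which forces the good radius above R. The last entry makes p \<delta> R
    absorb both L + 1 and ln \<epsilon>.\<close>
  define R0 where "R0 = max 1 (max u (max l (max g (max (1 / \<delta>) (((L + 1) + \<bar>ln \<epsilon>\<bar>) / (p * \<delta>))))))"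
  have R0: "1 \<le> R0" "u \<le> R0" "l \<le> R0" "g \<le> R0" "1 / \<delta> \<le> R0" "((L + 1) + \<bar>ln \<epsilon>\<bar>) / (p * \<delta>) \<le> R0"
    unfolding R0_def by linarith+
  show thesis
  proof (rule that)
    fix R and \<gamma> :: "complex set" and w z
    assume R: "R0 \<le> R" and \<gamma>: "connected \<gamma>" "w \<in> \<gamma>" "z \<in> \<gamma>"
      and wz: "norm w \<le> R" "exp (R powr (L + 1)) \<le> norm z"
    have "1 / \<delta> \<le> R" "((L + 1) + \<bar>ln \<epsilon>\<bar>) / (p * \<delta>) \<le> R"
      using R R0 by linarith+
    then have R1: "1 \<le> R" "1 \<le> \<delta> * R" "(L + 1) + \<bar>ln \<epsilon>\<bar> \<le> p * \<delta> * R"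
      using R R0(1) ed Lp by (simp_all add: pos_divide_le_eq mult_ac)
    have RL: "R \<le> R powr L" using R1 Lp powr_mono[of 1 L R] by simp
    have RL1: "R powr (L + 1) = R powr L * R" using R1 by (simp add: powr_add)
    have "R \<le> R powr L * (\<delta> * R)"
      using mult_mono[OF RL R1(2)] R1 by simp
    then have dR: "R \<le> \<delta> * R powr (L + 1)" by (simp add: RL1 mult_ac)
    define S where "S = exp (R powr (L + 1))"
    have "R \<le> R powr (L + 1)" using R1 Lp powr_mono[of 1 "L + 1" R] by simp
    then have "R \<le> S" unfolding S_def using exp_ge_add_one_self[of "R powr (L + 1)"] by linarith
    then obtain r where r: "S powr \<delta> < r" "r < S" "max_modulus r f powr \<epsilon> \<le> min_modulus r f"
      using g[of S] R R0 by auto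
    have Sd: "S powr \<delta> = exp (\<delta> * R powr (L + 1))" by (simp add: S_def exp_powr_real mult.commute)
    have Rr: "R \<le> r" using dR r(1) exp_ge_add_one_self[of "\<delta> * R powr (L + 1)"] unfolding Sd by linarith
    obtain \<zeta> where \<zeta>: "\<zeta> \<in> \<gamma>" "norm \<zeta> = r"
      using connected_meets_sphere[OF \<gamma>, of r] wz Rr r(2) by (auto simp: S_def)
    have "((L + 1) + \<bar>ln \<epsilon>\<bar>) * R powr L \<le> p * \<delta> * R * R powr L"
      using R1 by (intro mult_right_mono) auto
    moreover have "\<bar>ln \<epsilon>\<bar> \<le> \<bar>ln \<epsilon>\<bar> * R powr L"
      using mult_left_mono[of 1 "R powr L" "\<bar>ln \<epsilon>\<bar>"] RL R1 by simp
    \<comment> \<open>The extra factor R in R powr (L + 1) = R powr L * R pays for the losses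
      \<delta>, p and \<epsilon>.\<close>
    ultimately have exponent: "(L + 1) * R powr L \<le> ln \<epsilon> + p * (\<delta> * R powr (L + 1))"
      unfolding RL1 by (simp add: algebra_simps)
    have "exp (R powr L) powr (L + 1) = exp ((L + 1) * R powr L)"
      by (simp add: exp_powr_real mult.commute)
    also have "\<dots> \<le> exp (ln \<epsilon> + p * (\<delta> * R powr (L + 1)))"
      using exponent by simp
    also have "\<dots> = \<epsilon> * (S powr \<delta>) powr p"
      using ed by (simp add: Sd exp_add exp_powr_real mult_ac)
    also have "\<dots> \<le> \<epsilon> * r powr p"
      using r ed Lp by (intro mult_left_mono powr_mono2) auto
    finally have "exp (exp (R powr L) powr (L + 1)) \<le> exp (r powr p) powr \<epsilon>"
      by (simp add: exp_powr_real mult.commute)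
    also have "\<dots> \<le> max_modulus r f powr \<epsilon>"
      using l[of r] R R0 Rr ed by (intro powr_mono2) auto
    also have "\<dots> \<le> norm (f \<zeta>)" using r(3) min_modulus_le[of \<zeta> f] \<zeta> by simp
    finally have "exp (exp (R powr L) powr (L + 1)) \<le> norm (f \<zeta>)" .
    moreover have "norm (f w) \<le> exp (R powr L)"
      using norm_le_max_modulus[OF hol wz(1)] u[of R] R R0 by auto
    ultimately show "norm (f w) \<le> exp (R powr L) \<and>
        (\<exists>\<zeta>\<in>\<gamma>. exp (exp (R powr L) powr (L + 1)) \<le> norm (f \<zeta>))"
      using \<zeta> by blast
  qed (use Lp R0 in auto)
qed

text \<open>Each step replaces R' by exp (R' powr L) \<ge> R' + 1. Linear growth in n is a weak
  record of this, but it suffices to exceed any constant independent of n.\<close>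

lemma long_continuum_iterates:
  fixes f :: "complex \<Rightarrow> complex"
  assumes L: "1 \<le> L" "1 \<le> R0"
    and step: "\<And>R \<gamma> w z. \<lbrakk>R0 \<le> R; connected \<gamma>; w \<in> \<gamma>; z \<in> \<gamma>; norm w \<le> R; exp (R powr (L + 1)) \<le> norm z\<rbrakk>
      \<Longrightarrow> norm (f w) \<le> exp (R powr L) \<and> (\<exists>\<zeta>\<in>\<gamma>. exp (exp (R powr L) powr (L + 1)) \<le> norm (f \<zeta>))"
    and hol: "f holomorphic_on UNIV"
    and \<gamma>: "connected \<gamma>" "w \<in> \<gamma>" "z \<in> \<gamma>" "norm w \<le> R" "exp (R powr (L + 1)) \<le> norm z" "R0 \<le> R"
  shows "\<exists>R'\<ge>R + real n. norm ((f ^^ n) w) \<le> R' \<and> (\<exists>\<zeta>\<in>\<gamma>. exp (R' powr (L + 1)) \<le> norm ((f ^^ n) \<zeta>))"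
proof (induction n)
  case 0
  show ?case using \<gamma> by (intro exI[of _ R]) auto
next
  case (Suc n)
  then obtain R' \<zeta> where R': "R + real n \<le> R'" "norm ((f ^^ n) w) \<le> R'"
    "\<zeta> \<in> \<gamma>" "exp (R' powr (L + 1)) \<le> norm ((f ^^ n) \<zeta>)" by blast
  have "connected ((f ^^ n) ` \<gamma>)"
    by (intro connected_continuous_image \<gamma>(1) holomorphic_on_imp_continuous_on
        holomorphic_on_subset[OF holomorphic_funpow[OF hol]]) simp
  \<comment> \<open>The one-step result is applied to the image continuum; its far point is an image
    under \<open>f ^^ n\<close>, so the witness can be taken in the original \<gamma>.\<close>
  from step[OF _ this _ _ R'(2,4)] \<gamma> R'
  have *: "norm (f ((f ^^ n) w)) \<le> exp (R' powr L)"
    "\<exists>\<zeta>\<in>\<gamma>. exp (exp (R' powr L) powr (L + 1)) \<le> norm (f ((f ^^ n) \<zeta>))" by auto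
  have "R' \<le> R' powr L" using powr_mono[of 1 L R'] L R' \<gamma> by simp
  then have "R + real (Suc n) \<le> exp (R' powr L)"
    using exp_ge_add_one_self[of "R' powr L"] R'(1) by linarith
  with * show ?case by (intro exI[of _ "exp (R' powr L)"]) simp
qed

section \<open>Size of Fatou components and finiteness of \<open>B2\<close>\<close>

text \<open>A path from w to a too distant z is a long continuum. After n iterations
  \<open>tlog\<close> is at least R' powr (L + 1) \<ge> R' * R' somewhere on it but at most R' at w.
  The ratio is then at least R' \<ge> R + n, while comparability bounds it by a constant K.\<close>

lemma Fatou_component_bound:
  assumes "f \<in> class_Delta" "0 < lower_growth_order f" "growth_order f < \<infinity>"
  obtains L R0 where "1 \<le> L" "1 \<le> R0"
    "\<And>U w z R. \<lbrakk>U \<in> components (Fatou_set f); w \<in> U; z \<in> U; R0 \<le> R; norm w \<le> R\<rbrakk>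
       \<Longrightarrow> norm z < exp (R powr (L + 1))"
proof -
  have hol: "f holomorphic_on UNIV"
    using assms(1) by (simp add: class_Delta_def transcendental_entire_def)
  obtain L R0 where L: "1 \<le> L" "1 \<le> R0" and step:
    "\<And>R \<gamma> w z. \<lbrakk>R0 \<le> R; connected \<gamma>; w \<in> \<gamma>; z \<in> \<gamma>; norm w \<le> R; exp (R powr (L + 1)) \<le> norm z\<rbrakk>
      \<Longrightarrow> norm (f w) \<le> exp (R powr L) \<and> (\<exists>\<zeta>\<in>\<gamma>. exp (exp (R powr L) powr (L + 1)) \<le> norm (f \<zeta>))"
    using long_continuum_image[OF assms] by blast
  show thesis
  proof (rule that[OF L], rule ccontr)
    fix U w z R
    assume U: "U \<in> components (Fatou_set f)" "w \<in> U" "z \<in> U" and R: "R0 \<le> R" "norm w \<le> R"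
      and "\<not> norm z < exp (R powr (L + 1))"
    then have z: "exp (R powr (L + 1)) \<le> norm z" by simp
    have conU: "connected U" "U \<subseteq> Fatou_set f" "open U"
      using U in_components_connected in_components_subset open_components open_Fatou_set by blast+
    then obtain c where c: "path c" "path_image c \<subseteq> U" "pathstart c = w" "pathfinish c = z"
      using U connected_open_path_connected unfolding path_connected_def by metis
    define \<gamma> where "\<gamma> = path_image c"
    have \<gamma>: "connected \<gamma>" "compact \<gamma>" "\<gamma> \<subseteq> U" "w \<in> \<gamma>" "z \<in> \<gamma>"
      using c by (auto simp: \<gamma>_def connected_path_image compact_path_image)
    obtain K where K: "\<And>n x. \<lbrakk>1 \<le> n; x \<in> \<gamma>\<rbrakk> \<Longrightarrow> tlog ((f ^^ n) x) \<le> K * tlog ((f ^^ n) w)"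
      using Fatou_tlog_comparable[OF hol conU(1,2) \<gamma>(2,3) U(2)] by blast
    obtain n :: nat where n: "1 \<le> n" "K < real n"
      by (metis linorder_le_cases nless_le of_nat_1 of_nat_le_iff order_le_less_trans reals_Archimedean2)
    have "\<exists>R'\<ge>R + real n. norm ((f ^^ n) w) \<le> R' \<and> (\<exists>\<zeta>\<in>\<gamma>. exp (R' powr (L + 1)) \<le> norm ((f ^^ n) \<zeta>))"
      by (rule long_continuum_iterates[OF L _ hol \<gamma>(1,4,5) R(2) z R(1)]) (rule step)
    then obtain R' \<zeta> where R': "R + real n \<le> R'" "norm ((f ^^ n) w) \<le> R'"
      "\<zeta> \<in> \<gamma>" "exp (R' powr (L + 1)) \<le> norm ((f ^^ n) \<zeta>)"
      by blast
    have R'1: "1 \<le> R'" "K < R'" using R' R L n by linarith+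
    have "R' * R' = R' powr 2" using R'1 by (simp add: power2_eq_square)
    also have "\<dots> \<le> R' powr (L + 1)" using R'1 L by (intro powr_mono) auto
    also have "\<dots> = ln (exp (R' powr (L + 1)))" by simp
    also have "\<dots> \<le> ln (norm ((f ^^ n) \<zeta>))"
      using R'(4) exp_gt_zero[of "R' powr (L + 1)"] by (subst ln_le_cancel_iff) (auto intro: less_le_trans)
    also have "\<dots> \<le> tlog ((f ^^ n) \<zeta>)"
      using R'(4) exp_gt_zero[of "R' powr (L + 1)"] by (intro ln_norm_le_tlog) (auto intro: less_le_trans)
    also have "\<dots> \<le> K * tlog ((f ^^ n) w)" using K n R' by simp
    also have "\<dots> < R' * tlog ((f ^^ n) w)"
      using R'1 tlog_ge_1[of "(f ^^ n) w"] by (intro mult_strict_right_mono) auto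
    also have "\<dots> \<le> R' * R'"
    proof (intro mult_left_mono)
      have "tlog ((f ^^ n) w) \<le> ln (max (exp 1) R')" by (rule tlog_mono) (rule R')
      \<comment> \<open>Whichever term the maximum picks, the bound holds: ln (exp 1) = 1 \<le> R'
        or ln R' \<le> R'.\<close>
      also have "\<dots> \<le> R'"
        using R'1 ln_le_minus_one[of R'] by (auto simp: max_def)
      finally show "tlog ((f ^^ n) w) \<le> R'" .
    qed (use R'1 in auto)
    finally show False by simp
  qed
qed

lemma one_le_ln_add_3: "1 \<le> ln (norm (w::complex) + 3)"
  using exp_le norm_ge_zero[of w] by (subst ln_ge_iff) linarith+

theorem theorem4:
  fixes f :: "complex \<Rightarrow> complex"
  assumes "transcendental_entire f"
    and "Fatou_set f \<noteq> {}"
    and "f \<in> class_Delta"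
    and "0 < lower_growth_order f"
    and "lower_growth_order f \<le> growth_order f"
    and "growth_order f < \<infinity>"
  shows "Fatou_uniformly_bounded f"
proof -
  obtain L R0 where L: "1 \<le> L" "1 \<le> R0" and bound:
    "\<And>U w z R. \<lbrakk>U \<in> components (Fatou_set f); w \<in> U; z \<in> U; R0 \<le> R; norm w \<le> R\<rbrakk>
       \<Longrightarrow> norm z < exp (R powr (L + 1))"
    using Fatou_component_bound[OF assms(3,4,6)] by blast
  \<comment> \<open>The 4 bounds ln 31 from the additive constants; the rest bounds (L + 1)(ln R0 +
    l), where l = ln (|w| + 3) \<ge> 1.\<close>
  define C where "C = 4 + (L + 1) * (ln R0 + 1)"
  have C: "0 < C" using L by (auto simp: C_def intro!: add_pos_nonneg mult_nonneg_nonneg)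
  have key: "ln (ln (norm z + 30)) \<le> C * ln (norm w + 3)"
    if U: "U \<in> components (Fatou_set f)" "w \<in> U" "z \<in> U" for U w z
  proof -
    define l where "l = ln (norm w + 3)"
    have l: "1 \<le> l" unfolding l_def by (rule one_le_ln_add_3)
    \<comment> \<open>A product exceeds both R0 and |w| and keeps its logarithm additive, so the
      component bound becomes linear in l.\<close>
    define R where "R = R0 * (norm w + 3)"
    have w3: "0 < norm w + 3" by (simp add: add_nonneg_pos)
    have RR: "R0 \<le> R" "norm w \<le> R" "1 \<le> R"
      using L mult_mono[of 1 R0 "norm w + 3" "norm w + 3"] mult_mono[of R0 R0 1 "norm w + 3"]
      by (auto simp: R_def intro: order_trans)
    define T where "T = R powr (L + 1)"
    have T: "1 \<le> T" unfolding T_def using RR L by (intro ge_one_powr_ge_zero) auto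
    have lnT: "ln T = (L + 1) * (ln R0 + l)"
      using L w3 by (simp add: T_def R_def l_def ln_powr ln_mult)
    have "norm z < exp T" unfolding T_def by (rule bound[OF U RR(1,2)])
    moreover have "30 \<le> 30 * exp T" using T by simp
    ultimately have "norm z + 30 \<le> 31 * exp T" by linarith
    then have "ln (norm z + 30) \<le> ln (31 * exp T)"
      by (subst ln_le_cancel_iff) (auto intro: add_nonneg_pos)
    also have "\<dots> = ln 31 + T" by (simp add: ln_mult)
    also have "\<dots> \<le> 31 * T" using T ln_le_minus_one[of "31::real"] by simp
    finally have le: "ln (norm z + 30) \<le> 31 * T" .
    have "0 < ln (norm z + 30)" by (rule ln_gt_zero) (simp add: add_nonneg_pos add.commute add_strict_increasing2)
    with le T have "ln (ln (norm z + 30)) \<le> ln (31 * T)" by (subst ln_le_cancel_iff) auto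
    also have "\<dots> = ln 31 + ln T" using T by (simp add: ln_mult)
    also have "ln (31::real) \<le> 4"
    proof -
      have "(31::real) \<le> 2 ^ 5" by simp
      then have "ln (31::real) \<le> ln (2 ^ 5)" by (subst ln_le_cancel_iff) auto
      also have "\<dots> = 5 * ln (2::real)" by (subst ln_realpow) auto
      also have "\<dots> \<le> 4" using ln_2_less_1 ln2_le_25_over_36 by simp
      finally show ?thesis .
    qed
    also have "4 + ln T \<le> 4 * l + (L + 1) * (ln R0 * l + l)"
      unfolding lnT using l L mult_left_mono[OF l, of "ln R0"]
      by (intro add_mono mult_left_mono) auto
    also have "\<dots> = C * l" by (simp add: C_def algebra_simps)
    finally show ?thesis by (simp add: l_def)
  qed
  have "B2 f \<le> ereal C"
    unfolding B2_def
  proof (rule SUP_least)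
    fix U assume U: "U \<in> components (Fatou_set f)"
    let ?I = "INF w\<in>U. ereal (ln (norm w + 3))"
    obtain w0 where w0: "w0 \<in> U" using U in_components_nonempty by blast
    have I1: "1 \<le> ?I" using one_le_ln_add_3 by (intro INF_greatest) (simp add: one_ereal_def)
    have "?I \<le> ereal (ln (norm w0 + 3))" by (rule INF_lower[OF w0])
    \<comment> \<open>Knowing that the infimum is a finite positive real turns the extended quotient
      into an ordinary division.\<close>
    then obtain i where i: "?I = ereal i" "1 \<le> i"
      using I1 by (cases ?I) (auto simp: one_ereal_def)
    have "ereal (ln (ln (norm z + 30))) \<le> ereal (C * i)" if z: "z \<in> U" for z
    proof -
      \<comment> \<open>The estimate \<open>key\<close> holds for each w in U with the same z, so
        the infimum over w can be taken first and the supremum over z afterwards.\<close>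
      have "ereal (ln (ln (norm z + 30)) / C) \<le> ?I"
        using key[OF U _ z] C by (intro INF_greatest) (simp add: field_simps)
      then show ?thesis using i C by (simp add: field_simps)
    qed
    then have "(SUP z\<in>U. ereal (ln (ln (norm z + 30)))) \<le> ereal (C * i)" by (rule SUP_least)
    then show "(SUP z\<in>U. ereal (ln (ln (norm z + 30)))) / ?I \<le> ereal C"
      unfolding i using i(2) by (subst ereal_divide_le_pos) (auto simp: mult.commute)
  qed
  then show ?thesis unfolding Fatou_uniformly_bounded_def by (rule le_less_trans) simp
qed

end
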